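(* Let $K$ be a field with $\operatorname{char}(K)\neq 2$, let $n\ge 1$ and $0\le r\le n$ be integers, and let $\mathfrak{M}_n(r)$ be the inflated algebra, i.e. the $K$-vector space ${\rm M}_n(K)$ with multiplication $A\cdot B=APB$, where $P=\begin{bmatrix} I_r&0\\0&0\end{bmatrix}$. Let $\theta$ be a commuting map of $\mathfrak{M}_n(r)$. Then $\theta$ is standard. Moreover, every commuting map of $\mathfrak{M}_n(r)$ is proper if and only if $\hat{\mathcal{J}}=\emptyset$, where $\hat{\mathcal{J}}=\{r+1,\dots,n\}$ (i.e. $r=n$, so that $\mathfrak{M}_n(r)$ is the full matrix algebra ${\rm M}_n(K)$).
   Context: $P$ is the $n\times n$ matrix with the $r\times r$ identity matrix $I_r$ in the upper left corner and zeros elsewhere ($P=0$ if $r=0$); $\mathfrak{M}_n(r)$ is an associative, not necessarily unital, $K$-algebra. For an associative (not necessarily unital) $K$-algebra $\mathcal{A}$, with product $xy$, put $[x,y]=xy-yx$ and let $Z(\mathcal{A})$ be its center; for $\mathfrak{M}_n(r)$ the product used is $\cdot$, so $[A,B]=A\cdot B-B\cdot A$. A $K$-linear map $\theta:\mathcal{A}\to\mathcal{A}$ is commuting if $[\theta(x),x]=0$ for all $x\in\mathcal{A}$. A commuting map $\theta$ is proper if there are $\lambda\in Z(\mathcal{A})$ and a $K$-linear map $\mu:\mathcal{A}\to\mathcal{A}$ with range in $Z(\mathcal{A})$ such that $\theta(x)=\lambda x+\mu(x)$ for all $x\in\mathcal{A}$ (where $\lambda x$ is the product in $\mathcal{A}$).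 A commuting map $\theta$ is standard if there are $c\in K$, $\lambda\in Z(\mathcal{A})$ and a $K$-linear map $\mu:\mathcal{A}\to\mathcal{A}$ with range in $Z(\mathcal{A})$ such that $\theta(x)=cx+\lambda x+\mu(x)$ for all $x\in\mathcal{A}$.
   Formalization: The equivalence on properness is stated only for r ≥ 1: for r = 0 all products vanish, so every commuting map is proper although {1,…,n} is nonempty, and the equivalence fails. The claim that every commuting map is standard is kept for all 0 ≤ r ≤ n. *)

theory Defs
  imports "Jordan_Normal_Form.Matrix"
begin

(* An associative, not necessarily unital, K-algebra is given by a HOL-Algebra module record
   whose scalars are the elements of the type 'k.  The field "one" of the record carries no
   meaning and is never used. *)

definition alg_linear :: "('k::field, 'a, 'm) module_scheme \<Rightarrow> ('a \<Rightarrow> 'a) \<Rightarrow> bool" where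
  "alg_linear A f \<longleftrightarrow>
     f \<in> carrier A \<rightarrow> carrier A \<and>
     (\<forall>x\<in>carrier A. \<forall>y\<in>carrier A. f (x \<oplus>\<^bsub>A\<^esub> y) = f x \<oplus>\<^bsub>A\<^esub> f y) \<and>
     (\<forall>c. \<forall>x\<in>carrier A. f (c \<odot>\<^bsub>A\<^esub> x) = c \<odot>\<^bsub>A\<^esub> f x)"

definition alg_commutator :: "('k::field, 'a, 'm) module_scheme \<Rightarrow> 'a \<Rightarrow> 'a \<Rightarrow> 'a" where
  "alg_commutator A x y = (x \<otimes>\<^bsub>A\<^esub> y) \<ominus>\<^bsub>A\<^esub> (y \<otimes>\<^bsub>A\<^esub> x)"

definition alg_center :: "('k::field, 'a, 'm) module_scheme \<Rightarrow> 'a set" where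
  "alg_center A = {z \<in> carrier A. \<forall>x\<in>carrier A. z \<otimes>\<^bsub>A\<^esub> x = x \<otimes>\<^bsub>A\<^esub> z}"

definition commuting_map :: "('k::field, 'a, 'm) module_scheme \<Rightarrow> ('a \<Rightarrow> 'a) \<Rightarrow> bool" where
  "commuting_map A \<theta> \<longleftrightarrow>
     alg_linear A \<theta> \<and> (\<forall>x\<in>carrier A. alg_commutator A (\<theta> x) x = \<zero>\<^bsub>A\<^esub>)"

definition proper_commuting_map :: "('k::field, 'a, 'm) module_scheme \<Rightarrow> ('a \<Rightarrow> 'a) \<Rightarrow> bool" where
  "proper_commuting_map A \<theta> \<longleftrightarrow> commuting_map A \<theta> \<and>
     (\<exists>l\<in>alg_center A. \<exists>\<mu>. alg_linear A \<mu> \<and> \<mu> ` carrier A \<subseteq> alg_center A \<and>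
        (\<forall>x\<in>carrier A. \<theta> x = (l \<otimes>\<^bsub>A\<^esub> x) \<oplus>\<^bsub>A\<^esub> \<mu> x))"

definition standard_commuting_map :: "('k::field, 'a, 'm) module_scheme \<Rightarrow> ('a \<Rightarrow> 'a) \<Rightarrow> bool" where
  "standard_commuting_map A \<theta> \<longleftrightarrow> commuting_map A \<theta> \<and>
     (\<exists>c::'k. \<exists>l\<in>alg_center A. \<exists>\<mu>. alg_linear A \<mu> \<and> \<mu> ` carrier A \<subseteq> alg_center A \<and>
        (\<forall>x\<in>carrier A. \<theta> x = (c \<odot>\<^bsub>A\<^esub> x) \<oplus>\<^bsub>A\<^esub> (l \<otimes>\<^bsub>A\<^esub> x) \<oplus>\<^bsub>A\<^esub> \<mu> x))"

definition inflation_matrix :: "nat \<Rightarrow> nat \<Rightarrow> 'k::field mat" where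
  "inflation_matrix n r =
     four_block_mat (1\<^sub>m r) (0\<^sub>m r (n - r)) (0\<^sub>m (n - r) r) (0\<^sub>m (n - r) (n - r))"

definition inflated_algebra :: "nat \<Rightarrow> nat \<Rightarrow> ('k::field, 'k mat) module" where
  "inflated_algebra n r =
     (module_mat TYPE('k) n n)\<lparr>mult := (\<lambda>A B. A * inflation_matrix n r * B)\<rparr>"

lemma inflated_algebra_simps:
  "carrier (inflated_algebra n r) = carrier_mat n n"
  "mult (inflated_algebra n r) = (\<lambda>A B. A * inflation_matrix n r * B)"
  "zero (inflated_algebra n r) = 0\<^sub>m n n"
  "add (inflated_algebra n r) = (+)"
  "Module.smult (inflated_algebra n r) = (\<cdot>\<^sub>m)"
  by (simp_all add: inflated_algebra_def module_mat_simps)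

lemma inflation_matrix_0: "inflation_matrix n 0 = (0\<^sub>m n n :: 'k::field mat)"
  by (rule eq_matI) (auto simp: inflation_matrix_def)

(* The zero algebra (r = 0) is its own center, so all its commuting maps are proper although
   {r+1..n} is nonempty. *)
lemma commuting_map_rank_0_proper:
  fixes \<theta> :: "'k::field mat \<Rightarrow> 'k mat"
  assumes "commuting_map (inflated_algebra n 0) \<theta>"
  shows "proper_commuting_map (inflated_algebra n 0) \<theta>"
proof -
  have lin: "alg_linear (inflated_algebra n 0) \<theta>"
    using assms by (simp add: commuting_map_def)
  then have maps: "\<theta> x \<in> carrier_mat n n" if "x \<in> carrier_mat n n" for x
    using that by (auto simp: alg_linear_def inflated_algebra_simps)
  have ctr: "alg_center (inflated_algebra n 0) = (carrier_mat n n :: 'k mat set)"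
    by (auto simp: alg_center_def inflated_algebra_simps inflation_matrix_0)
  have "\<forall>x\<in>carrier_mat n n. \<theta> x = 0\<^sub>m n n * inflation_matrix n 0 * x + \<theta> x"
    using maps by (auto simp: inflation_matrix_0)
  moreover have "\<theta> ` carrier_mat n n \<subseteq> carrier_mat n n"
    using maps by auto
  ultimately show ?thesis
    unfolding proper_commuting_map_def ctr inflated_algebra_simps
    using assms lin by (intro conjI bexI[of _ "0\<^sub>m n n"] exI[of _ \<theta>]) auto
qed

end

theory Submission
  imports Defs
begin

text \<open>
  Write \<open>T\<^sup>i\<^sup>j\<close> for the image of the matrix unit \<open>E\<^sub>i\<^sub>j\<close> under a commuting map \<open>\<theta>\<close>. Polarising
  \<open>[\<theta>(x), x] = 0\<close> on pairs of matrix units gives linear relations between the entries of the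
  \<open>T\<^sup>i\<^sup>j\<close>. They force one scalar \<open>c\<close> such that all \<open>T\<^sup>i\<^sup>j - c E\<^sub>i\<^sub>j\<close> are central. For \<open>\<mu> = \<theta> - c id\<close>
  and any \<open>x\<close>, polarisation once more gives \<open>[\<mu>(x), E\<^sub>k\<^sub>l] = [x, \<mu>(E\<^sub>k\<^sub>l)] = 0\<close>, so \<open>\<mu>\<close> takes central
  values everywhere. If \<open>r = n\<close> the term \<open>c x\<close> is multiplication by the central element \<open>c I\<close>;
  if \<open>1 \<le> r < n\<close> the center annihilates the algebra and the identity map is not proper.
\<close>

section \<open>Matrix units and entries of the inflated product\<close>

definition mat_unit :: "nat \<Rightarrow> nat \<Rightarrow> nat \<Rightarrow> 'k::field mat" where
  "mat_unit n k l = mat n n (\<lambda>(i, j). of_bool (k = i \<and> l = j))"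

lemma mat_unit_carrier [simp]: "mat_unit n k l \<in> carrier_mat n n"
  by (simp add: mat_unit_def)

lemma mat_unit_dim [simp]: "dim_row (mat_unit n k l) = n" "dim_col (mat_unit n k l) = n"
  by (simp_all add: mat_unit_def)

lemma mat_unit_index [simp]:
  "a < n \<Longrightarrow> b < n \<Longrightarrow> mat_unit n k l $$ (a, b) = of_bool (k = a \<and> l = b)"
  by (simp add: mat_unit_def)

text \<open>The \<open>(a, b)\<close> entry of \<open>[x, y]\<close> in the inflated algebra: the
  matrix \<open>P\<close> between the factors cuts the inner summation off at
  \<open>r\<close>.\<close>

definition comm_entry :: "nat \<Rightarrow> 'k::field mat \<Rightarrow> 'k mat \<Rightarrow> nat \<Rightarrow> nat \<Rightarrow> 'k" where
  "comm_entry r x y a b = (\<Sum>c<r. x $$ (a, c) * y $$ (c, b) - y $$ (a, c) * x $$ (c, b))"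

lemma mult_mat_entry:
  assumes "A \<in> carrier_mat n n" "B \<in> carrier_mat n n" "a < n" "b < n"
  shows "(A * B) $$ (a, b) = (\<Sum>c<n. A $$ (a, c) * B $$ (c, b))"
  using assms by (auto simp: scalar_prod_def atLeast0LessThan intro!: sum.cong)

lemma inflated_mult_entry:
  fixes x y :: "'k::field mat"
  assumes x: "x \<in> carrier_mat n n" and y: "y \<in> carrier_mat n n"
    and r: "r \<le> n" and a: "a < n" and b: "b < n"
  shows "(x * inflation_matrix n r * y) $$ (a, b) = (\<Sum>c<r. x $$ (a, c) * y $$ (c, b))"
proof -
  have P: "inflation_matrix n r \<in> carrier_mat n n"
    using r by (auto simp: inflation_matrix_def)
  have Pe: "inflation_matrix n r $$ (i, j) = (of_bool (i = j \<and> i < r) :: 'k)"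
    if "i < n" "j < n" for i j
    using that r by (auto simp: inflation_matrix_def)
  \<comment> \<open>Right multiplication by \<open>P\<close> erases the columns with index at least
    \<open>r\<close>.\<close>
  have xP: "(x * inflation_matrix n r) $$ (a, c) = (if c < r then x $$ (a, c) else 0)"
    if c: "c < n" for c
  proof -
    have "(x * inflation_matrix n r) $$ (a, c)
        = (\<Sum>d<n. if d = c then x $$ (a, d) * of_bool (d < r) else 0)"
      unfolding mult_mat_entry[OF x P a c] using c by (intro sum.cong) (auto simp: Pe)
    also have "\<dots> = (if c < r then x $$ (a, c) else 0)"
      using c by simp
    finally show ?thesis .
  qed
  have "(x * inflation_matrix n r * y) $$ (a, b)
      = (\<Sum>c<n. (if c < r then x $$ (a, c) else 0) * y $$ (c, b))"
    unfolding mult_mat_entry[OF mult_carrier_mat[OF x P] y a b]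
    by (intro sum.cong) (simp_all only: xP lessThan_iff)
  also have "\<dots> = (\<Sum>c<r. x $$ (a, c) * y $$ (c, b))"
    using r by (intro sum.mono_neutral_cong_right) auto
  finally show ?thesis .
qed

text \<open>Subtraction in a record rests on a definite description of the additive inverse; it is
  evaluated by checking that \<open>- y\<close> is an inverse and the only one.\<close>

lemma inflated_minus:
  fixes x y :: "'k::field mat"
  assumes "x \<in> carrier_mat n n" "y \<in> carrier_mat n n"
  shows "x \<ominus>\<^bsub>inflated_algebra n r\<^esub> y = x - y"
proof -
  let ?A = "inflated_algebra n r :: ('k, 'k mat) module"
  have "\<ominus>\<^bsub>?A\<^esub> y = - y"
    unfolding a_inv_def m_inv_def
  proof (rule the_equality)
    show "- y \<in> carrier (add_monoid ?A) \<and> y \<otimes>\<^bsub>add_monoid ?A\<^esub> - y = \<one>\<^bsub>add_monoid ?A\<^esub> \<and>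
        - y \<otimes>\<^bsub>add_monoid ?A\<^esub> y = \<one>\<^bsub>add_monoid ?A\<^esub>"
      using assms by (auto simp: inflated_algebra_simps)
  next
    fix z assume "z \<in> carrier (add_monoid ?A) \<and> y \<otimes>\<^bsub>add_monoid ?A\<^esub> z = \<one>\<^bsub>add_monoid ?A\<^esub> \<and>
        z \<otimes>\<^bsub>add_monoid ?A\<^esub> y = \<one>\<^bsub>add_monoid ?A\<^esub>"
    then have z: "z \<in> carrier_mat n n" and e: "z + y = 0\<^sub>m n n"
      by (auto simp: inflated_algebra_simps)
    show "z = - y"
    proof (rule eq_matI)
      fix i j assume "i < dim_row (- y)" "j < dim_col (- y)"
      then have ij: "i < n" "j < n" using assms by auto
      then have "(z + y) $$ (i, j) = 0" using e by simp
      then show "z $$ (i, j) = (- y) $$ (i, j)"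
        using ij z assms by (simp add: eq_neg_iff_add_eq_0)
    qed (use z assms in auto)
  qed
  then show ?thesis
    using assms by (simp add: a_minus_def inflated_algebra_simps add_uminus_minus_mat)
qed

lemma inflated_commute_iff:
  fixes x y :: "'k::field mat"
  assumes "x \<in> carrier_mat n n" "y \<in> carrier_mat n n" "r \<le> n"
  shows "x * inflation_matrix n r * y = y * inflation_matrix n r * x
    \<longleftrightarrow> (\<forall>a<n. \<forall>b<n. comm_entry r x y a b = 0)"
proof -
  have P: "inflation_matrix n r \<in> carrier_mat n n"
    using assms by (auto simp: inflation_matrix_def)
  have "x * inflation_matrix n r * y = y * inflation_matrix n r * x \<longleftrightarrow>
    (\<forall>a<n. \<forall>b<n. (x * inflation_matrix n r * y) $$ (a, b) = (y * inflation_matrix n r * x) $$ (a, b))"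
    using assms P by (auto simp del: index_mult_mat(1) intro!: eq_matI)
  then show ?thesis
    using assms by (simp add: inflated_mult_entry comm_entry_def sum_subtractf del: index_mult_mat(1))
qed

lemma minus_mat_eq_zero_iff:
  fixes u v :: "'k::ab_group_add mat"
  assumes "u \<in> carrier_mat m n" "v \<in> carrier_mat m n"
  shows "u - v = 0\<^sub>m m n \<longleftrightarrow> u = v"
proof
  assume e: "u - v = 0\<^sub>m m n"
  show "u = v"
  proof (rule eq_matI)
    fix i j assume "i < dim_row v" "j < dim_col v"
    then have ij: "i < m" "j < n" using assms by auto
    then have "(u - v) $$ (i, j) = 0" using e by simp
    then show "u $$ (i, j) = v $$ (i, j)" using ij assms by simp
  qed (use assms in auto)
qed (use assms in auto)

lemma alg_commutator_zero_iff:
  fixes x y :: "'k::field mat"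
  assumes "x \<in> carrier_mat n n" "y \<in> carrier_mat n n" "r \<le> n"
  shows "alg_commutator (inflated_algebra n r) x y = \<zero>\<^bsub>inflated_algebra n r\<^esub>
    \<longleftrightarrow> (\<forall>a<n. \<forall>b<n. comm_entry r x y a b = 0)"
proof -
  have P: "inflation_matrix n r \<in> carrier_mat n n"
    using assms by (auto simp: inflation_matrix_def)
  let ?u = "x * inflation_matrix n r * y" and ?v = "y * inflation_matrix n r * x"
  have uv: "?u \<in> carrier_mat n n" "?v \<in> carrier_mat n n"
    using assms P by auto
  then have "?u - ?v = 0\<^sub>m n n \<longleftrightarrow> ?u = ?v"
    by (rule minus_mat_eq_zero_iff)
  then show ?thesis
    using inflated_commute_iff[OF assms] uv
    by (simp add: alg_commutator_def inflated_minus inflated_algebra_simps)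
qed

text \<open>In each of the two products only one summand survives: \<open>c = k\<close> in the first
  and \<open>c = l\<close> in the second.\<close>

lemma comm_entry_mat_unit:
  fixes z :: "'k::field mat"
  assumes "z \<in> carrier_mat n n" "r \<le> n" "a < n" "b < n" "k < n" "l < n"
  shows "comm_entry r z (mat_unit n k l) a b
    = of_bool (k < r \<and> l = b) * z $$ (a, k) - of_bool (l < r \<and> a = k) * z $$ (l, b)"
proof -
  have "comm_entry r z (mat_unit n k l) a b
    = (\<Sum>c<r. (if c = k then of_bool (l = b) * z $$ (a, c) else 0)
        - (if c = l then of_bool (a = k) * z $$ (c, b) else 0))"
    unfolding comm_entry_def using assms by (intro sum.cong) auto
  then show ?thesis
    by (simp add: sum_subtractf)
qed

lemma comm_entry_minus: "comm_entry r x y a b = - comm_entry r y x a b"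
  by (simp add: comm_entry_def sum_negf[symmetric])

section \<open>The center in coordinates\<close>

text \<open>For \<open>r = n\<close> these are the scalar matrices. For \<open>r < n\<close> the
  weights \<open>of_bool\<close> force the upper left block to vanish, and only the lower right
  block is free. The argument is an entry function, so that shifted coefficient families fit as
  well.\<close>

definition central_entries :: "nat \<Rightarrow> nat \<Rightarrow> (nat \<Rightarrow> nat \<Rightarrow> 'k::field) \<Rightarrow> bool" where
  "central_entries n r z \<longleftrightarrow>
    (\<forall>a<n. \<forall>b<n. a \<noteq> b \<longrightarrow> a < r \<or> b < r \<longrightarrow> z a b = 0) \<and>
    (\<forall>k<n. \<forall>l<n. of_bool (k < r) * z k k = of_bool (l < r) * z l l)"

lemma central_entries_off:
  "central_entries n r z \<Longrightarrow> a < n \<Longrightarrow> b < n \<Longrightarrow> a \<noteq> b \<Longrightarrow> a < r \<or> b < r \<Longrightarrow> z a b = 0"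
  unfolding central_entries_def by blast

lemma central_entries_diag:
  "central_entries n r z \<Longrightarrow> k < n \<Longrightarrow> l < n \<Longrightarrow>
    of_bool (k < r) * z k k = of_bool (l < r) * z l l"
  unfolding central_entries_def by blast

lemma central_entries_cong:
  assumes "\<And>a b. a < n \<Longrightarrow> b < n \<Longrightarrow> z a b = w a b"
  shows "central_entries n r z \<longleftrightarrow> central_entries n r w"
  using assms by (simp add: central_entries_def)

text \<open>Vanishing off-diagonal entries leave one term of each product, and their difference is
  \<open>y $$ (a, b)\<close> times a difference of weighted diagonal entries.\<close>

lemma central_entries_comm:
  fixes z y :: "'k::field mat"
  assumes z: "central_entries n r (\<lambda>a b. z $$ (a, b))" and r: "r \<le> n"
    and ab: "a < n" "b < n"
  shows "comm_entry r z y a b = 0"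
proof -
  have off: "z $$ (i, j) = 0" if "i < n" "j < n" "i \<noteq> j" "i < r \<or> j < r" for i j
    using central_entries_off[OF z] that by blast
  have "comm_entry r z y a b
    = (\<Sum>c<r. (if c = a then z $$ (a, a) * y $$ (a, b) else 0)
        - (if c = b then y $$ (a, b) * z $$ (b, b) else 0))"
    unfolding comm_entry_def using r ab by (intro sum.cong) (auto simp: off)
  also have "\<dots> = (of_bool (a < r) * z $$ (a, a) - of_bool (b < r) * z $$ (b, b)) * y $$ (a, b)"
    by (simp add: sum_subtractf algebra_simps)
  also have "\<dots> = 0"
    using central_entries_diag[OF z ab] by simp
  finally show ?thesis .
qed

text \<open>Commuting with matrix units suffices: the diagonal units give the off-diagonal zeros,
  and entry \<open>(k, l)\<close> of the commutator with the unit at \<open>(k, l)\<close> compares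
  two diagonal entries.\<close>

lemma central_entriesI:
  fixes z :: "'k::field mat"
  assumes z: "z \<in> carrier_mat n n" and r: "r \<le> n"
    and comm: "\<And>k l a b. k < n \<Longrightarrow> l < n \<Longrightarrow> a < n \<Longrightarrow> b < n \<Longrightarrow>
      comm_entry r z (mat_unit n k l) a b = 0"
  shows "central_entries n r (\<lambda>a b. z $$ (a, b))"
  unfolding central_entries_def
proof (intro conjI allI impI)
  fix a b assume ab: "a < n" "b < n" "a \<noteq> b" "a < r \<or> b < r"
  show "z $$ (a, b) = 0"
    using ab comm[of b b a b] comm[of a a a b]
    by (auto simp: comm_entry_mat_unit[OF z r])
next
  fix k l assume "k < n" "l < n"
  then show "of_bool (k < r) * z $$ (k, k) = of_bool (l < r) * z $$ (l, l)"
    using comm[of k l k l] by (simp add: comm_entry_mat_unit[OF z r])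
qed

lemma alg_center_inflated:
  fixes z :: "'k::field mat"
  assumes "r \<le> n"
  shows "z \<in> alg_center (inflated_algebra n r)
    \<longleftrightarrow> z \<in> carrier_mat n n \<and> central_entries n r (\<lambda>a b. z $$ (a, b))"
  using assms central_entriesI[of z n r] central_entries_comm[of n r z]
  by (auto simp: alg_center_def inflated_algebra_simps inflated_commute_iff)

section \<open>Linear relations between the coefficients of a commuting map\<close>

text \<open>\<open>T i j a b\<close> is the \<open>(a, b)\<close> entry of the image of \<open>E\<^sub>i\<^sub>j\<close>; the assumption is the polarised
  commuting identity for \<open>E\<^sub>i\<^sub>j\<close> and \<open>E\<^sub>k\<^sub>l\<close>.\<close>

locale commuting_coeffs =
  fixes n r :: nat and T :: "nat \<Rightarrow> nat \<Rightarrow> nat \<Rightarrow> nat \<Rightarrow> 'k::field"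
  assumes polar: "\<And>i j k l a b. \<lbrakk>i < n; j < n; k < n; l < n; a < n; b < n\<rbrakk> \<Longrightarrow>
    of_bool (k < r \<and> l = b) * T i j a k - of_bool (l < r \<and> a = k) * T i j l b
    = of_bool (j < r \<and> a = i) * T k l j b - of_bool (i < r \<and> j = b) * T k l a i"
begin

text \<open>Transposition reverses products and fixes \<open>P\<close>, so conjugating a commuting
  map with it gives a commuting map. Every result on columns thus has a twin on rows.\<close>

lemma transposed: "commuting_coeffs n r (\<lambda>i j a b. T j i b a)"
proof
  fix i j k l a b assume *: "i < n" "j < n" "k < n" "l < n" "a < n" "b < n"
  show "of_bool (k < r \<and> l = b) * T j i k a - of_bool (l < r \<and> a = k) * T j i b l
    = of_bool (j < r \<and> a = i) * T l k b j - of_bool (i < r \<and> j = b) * T l k i a"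
  proof -
    have flip: "(a = k) = (k = a)" "(l = b) = (b = l)" "(a = i) = (i = a)" "(j = b) = (b = j)"
      by auto
    show ?thesis
      unfolding flip using polar[of j i l k b a] * by (metis minus_diff_eq)
  qed
qed

text \<open>The identity map is commuting, so subtracting a multiple of it preserves the
  relations.\<close>

lemma shifted: "commuting_coeffs n r (\<lambda>i j a b. T i j a b - c * of_bool (i = a \<and> j = b))"
proof
  fix i j k l a b assume *: "i < n" "j < n" "k < n" "l < n" "a < n" "b < n"
  show "of_bool (k < r \<and> l = b) * (T i j a k - c * of_bool (i = a \<and> j = k))
      - of_bool (l < r \<and> a = k) * (T i j l b - c * of_bool (i = l \<and> j = b))
    = of_bool (j < r \<and> a = i) * (T k l j b - c * of_bool (k = j \<and> l = b))
      - of_bool (i < r \<and> j = b) * (T k l a i - c * of_bool (k = a \<and> l = i))"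
    (is "?p * (?t1 - c * ?d1) - ?q * (?t2 - c * ?d2) = ?u * (?t3 - c * ?d3) - ?v * (?t4 - c * ?d4)")
  proof -
    \<comment> \<open>These are the entries of the two products of the units at
      \<open>(i, j)\<close> and \<open>(k, l)\<close>, each read in two ways.\<close>
    have "?p * ?d1 = ?u * ?d3" "?q * ?d2 = ?v * ?d4"
      by (auto simp: of_bool_def)
    then have "?p * (c * ?d1) = ?u * (c * ?d3)" "?q * (c * ?d2) = ?v * (c * ?d4)"
      by (simp_all only: mult.left_commute[of _ c])
    moreover have "x1 - e1 - (x2 - e2) = x3 - e3 - (x4 - e4)"
      if "x1 - x2 = x3 - x4" "e1 = e3" "e2 = e4" for x1 x2 x3 x4 e1 e2 e3 e4 :: 'k
    proof -
      have "x1 - e1 - (x2 - e2) = x1 - x2 - (e1 - e2)" by simp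
      also have "\<dots> = x3 - e3 - (x4 - e4)" unfolding that by simp
      finally show ?thesis .
    qed
    ultimately show ?thesis
      unfolding right_diff_distrib using polar[OF *] by blast
  qed
qed

lemma other_row_zero:
  assumes "i < n" "j < n" "a < n" "k < r" "k < n" "a \<noteq> i" "a \<noteq> k"
  shows "T i j a k = 0"
proof -
  \<comment> \<open>Since \<open>a\<close> and \<open>k\<close> are distinct, one of them differs
    from \<open>j\<close>.\<close>
  obtain l where "l < n" "l \<noteq> j"
    using that[of a] that[of k] assms by metis
  then show ?thesis
    using polar[of i j k l a l] assms by auto
qed

lemma row_transfer:
  assumes "i < n" "j < n" "l < n" "k < r" "k < n" "i \<noteq> k" "l \<noteq> j"
  shows "T i j i k = of_bool (j < r) * T k l j l"
  using polar[of i j k l i l] assms by auto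

text \<open>Taking \<open>l = k\<close> in \<open>row_transfer\<close> leads to an off-diagonal
  entry of the image of a diagonal unit, where \<open>other_row_zero\<close> applies.\<close>

lemma other_column_zero:
  assumes "i < n" "j < n" "k < r" "k < n" "i \<noteq> k" "k \<noteq> j"
  shows "T i j i k = 0"
  using row_transfer[of i j k k] other_row_zero[of k k j k] assms by auto

lemma off_diagonal_zero:
  assumes "i < n" "j < n" "k < r" "k < n" "a < n" "a \<noteq> k" "\<not> (a = i \<and> k = j)"
  shows "T i j a k = 0"
  using other_row_zero[of i j a k] other_column_zero[of i j k] assms by auto

text \<open>Reading \<open>(i, j)\<close> as an edge, the coefficient of a unit in its own image is
  passed on to any edge leaving \<open>j\<close>, provided \<open>j < r\<close>.\<close>

lemma diagonal_coeff_eq: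
  assumes "i < n" "j < n" "l < n" "j < r" "i \<noteq> j" "l \<noteq> j"
  shows "T i j i j = T j l j l"
  using row_transfer[of i j l j] assms by auto

text \<open>Any two such edges are linked by paths through the index 0, which is below
  \<open>r\<close> as soon as some index is.\<close>

lemma diagonal_coeff_const:
  assumes r: "r \<le> n" and ij: "i < n" "j < n" "i \<noteq> j" "i < r \<or> j < r"
  shows "T i j i j = T 0 1 0 1"
proof -
  have eq: "T j l j l = T 0 1 0 1" if "j < r" "l < n" "l \<noteq> j" for j l
  proof (cases "j = 0")
    case True
    with that r show ?thesis
      using diagonal_coeff_eq[of 1 0 l] diagonal_coeff_eq[of 1 0 1] by auto
  next
    case False
    with that r show ?thesis
      using diagonal_coeff_eq[of 0 j l] diagonal_coeff_eq[of j 0 1] diagonal_coeff_eq[of 1 0 j]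
      using diagonal_coeff_eq[of j 0 j]
      by (cases "j = 1") (auto)
  qed
  show ?thesis
    using eq[of i j] eq[of j i] diagonal_coeff_eq[of i j i] ij by auto
qed

text \<open>The premise \<open>off\<close> has no exception at \<open>(a, b) = (i, j)\<close>; it is
  meant for the shifted coefficients.\<close>

lemma diagonal_equal:
  assumes two: "(2::'k) \<noteq> 0" and ij: "i < n" "j < n" and kl: "k < n" "l < n"
    and off: "\<And>i j a b. \<lbrakk>i < n; j < n; a < n; b < n; a \<noteq> b; a < r \<or> b < r\<rbrakk> \<Longrightarrow> T i j a b = 0"
  shows "of_bool (k < r) * T i j k k = of_bool (l < r) * T i j l l"
proof (cases "k = l")
  case ne: False
  let ?d = "of_bool (k < r) * T i j k k - of_bool (l < r) * T i j l l"
  have e: "?d = of_bool (j < r \<and> k = i) * T k l j l - of_bool (i < r \<and> j = l) * T k l k i"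
    using polar[of i j k l k l] ij kl by simp
  show ?thesis
  proof (cases "k = i \<and> l = j")
    case True
    \<comment> \<open>Polarising a unit with itself only shows that the difference equals its own
      negative; here the characteristic matters.\<close>
    then have "?d = - ?d" using e by auto
    then have "2 * ?d = 0" by (metis add.right_inverse mult_2)
    then show ?thesis using two by (metis eq_iff_diff_eq_0 mult_eq_0_iff)
  next
    case False
    then have "?d = 0"
      unfolding e using off[of k l j l] off[of k l k i] ij kl by auto
    then show ?thesis by simp
  qed
qed simp

lemma central_shift:
  assumes two: "(2::'k) \<noteq> 0" and r: "r \<le> n"
  obtains c where "\<And>i j. i < n \<Longrightarrow> j < n \<Longrightarrow>
    central_entries n r (\<lambda>a b. T i j a b - c * of_bool (i = a \<and> j = b))"
proof
  \<comment> \<open>For \<open>n = 1\<close> the index \<open>1\<close> is out of range, but then any scalar will do.\<close>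
  let ?S = "\<lambda>i j a b. T i j a b - T 0 1 0 1 * of_bool (i = a \<and> j = b)"
  interpret tr: commuting_coeffs n r "\<lambda>i j a b. T j i b a" by (rule transposed)
  interpret sh: commuting_coeffs n r ?S by (rule shifted)
  have off: "?S i j a b = 0"
    if "i < n" "j < n" "a < n" "b < n" "a \<noteq> b" "a < r \<or> b < r" for i j a b
  proof (cases "a = i \<and> b = j")
    case True
    then show ?thesis using diagonal_coeff_const[OF r, of i j] that by auto
  next
    case False
    \<comment> \<open>The column version settles \<open>b < r\<close>, its transpose
      \<open>a < r\<close>.\<close>
    then show ?thesis
      using off_diagonal_zero[of i j b a] tr.off_diagonal_zero[of j i a b] that by auto
  qed
  fix i j assume "i < n" "j < n"
  then show "central_entries n r (?S i j)"
    unfolding central_entries_def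
    by (intro conjI allI impI off sh.diagonal_equal[OF two]) assumption+
qed

end

section \<open>Splitting a commuting map into a scalar and a central part\<close>

text \<open>Expanding \<open>[\<theta>(x + y), x + y] = 0\<close> leaves only the mixed
  terms.\<close>

lemma commuting_map_polar:
  fixes \<theta> :: "'k::field mat \<Rightarrow> 'k mat"
  assumes \<theta>: "commuting_map (inflated_algebra n r) \<theta>" and r: "r \<le> n"
    and x: "x \<in> carrier_mat n n" and y: "y \<in> carrier_mat n n" and ab: "a < n" "b < n"
  shows "comm_entry r (\<theta> x) y a b = comm_entry r x (\<theta> y) a b"
proof -
  have maps: "\<theta> u \<in> carrier_mat n n" if "u \<in> carrier_mat n n" for u
    using \<theta> that by (auto simp: commuting_map_def alg_linear_def inflated_algebra_simps)
  have add: "\<theta> (x + y) = \<theta> x + \<theta> y"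
    using \<theta> x y by (auto simp: commuting_map_def alg_linear_def inflated_algebra_simps)
  have zero: "comm_entry r (\<theta> u) u a b = 0" if u: "u \<in> carrier_mat n n" for u
    using \<theta> ab alg_commutator_zero_iff[OF maps[OF u] u r] u
    by (auto simp: commuting_map_def inflated_algebra_simps(1))
  have "comm_entry r (\<theta> (x + y)) (x + y) a b
    = comm_entry r (\<theta> x) x a b + comm_entry r (\<theta> x) y a b
      + comm_entry r (\<theta> y) x a b + comm_entry r (\<theta> y) y a b"
    unfolding comm_entry_def add sum.distrib[symmetric]
    using maps[OF x] maps[OF y] x y r ab by (intro sum.cong) (auto simp: algebra_simps)
  then have "comm_entry r (\<theta> x) y a b + comm_entry r (\<theta> y) x a b = 0"
    using zero[OF x] zero[OF y] zero[of "x + y"] x y by simp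
  then have "comm_entry r (\<theta> x) y a b = - comm_entry r (\<theta> y) x a b"
    by (simp add: eq_neg_iff_add_eq_0)
  then show ?thesis
    using comm_entry_minus[of r x "\<theta> y" a b] by simp
qed

text \<open>Common source of the standard form and of properness for \<open>r = n\<close>, which
  differ in how they absorb \<open>c \<cdot>\<^sub>m x\<close>.\<close>

lemma commuting_map_decomposition:
  fixes \<theta> :: "'k::field mat \<Rightarrow> 'k mat"
  assumes \<theta>: "commuting_map (inflated_algebra n r) \<theta>" and r: "r \<le> n"
    and two: "(2::'k) \<noteq> 0"
  obtains \<mu> c where "alg_linear (inflated_algebra n r) \<mu>"
    "\<mu> ` carrier (inflated_algebra n r) \<subseteq> alg_center (inflated_algebra n r)"
    "\<forall>x\<in>carrier_mat n n. \<theta> x = c \<cdot>\<^sub>m x + \<mu> x"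
proof -
  have maps: "\<theta> u \<in> carrier_mat n n" if "u \<in> carrier_mat n n" for u
    using \<theta> that by (auto simp: commuting_map_def alg_linear_def inflated_algebra_simps)
  have add: "\<theta> (x + y) = \<theta> x + \<theta> y" if "x \<in> carrier_mat n n" "y \<in> carrier_mat n n" for x y
    using \<theta> that by (auto simp: commuting_map_def alg_linear_def inflated_algebra_simps)
  have scale: "\<theta> (d \<cdot>\<^sub>m x) = d \<cdot>\<^sub>m \<theta> x" if "x \<in> carrier_mat n n" for d x
    using \<theta> that by (auto simp: commuting_map_def alg_linear_def inflated_algebra_simps)
  interpret commuting_coeffs n r "\<lambda>i j a b. \<theta> (mat_unit n i j) $$ (a, b)"
  proof
    fix i j k l a b assume *: "i < n" "j < n" "k < n" "l < n" "a < n" "b < n"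
    show "of_bool (k < r \<and> l = b) * \<theta> (mat_unit n i j) $$ (a, k)
        - of_bool (l < r \<and> a = k) * \<theta> (mat_unit n i j) $$ (l, b)
      = of_bool (j < r \<and> a = i) * \<theta> (mat_unit n k l) $$ (j, b)
        - of_bool (i < r \<and> j = b) * \<theta> (mat_unit n k l) $$ (a, i)"
      using commuting_map_polar[OF \<theta> r, of "mat_unit n i j" "mat_unit n k l" a b] *
        comm_entry_minus[of r "mat_unit n i j" "\<theta> (mat_unit n k l)" a b]
      by (simp add: comm_entry_mat_unit[OF maps r])
  qed
  obtain c where c: "\<And>i j. i < n \<Longrightarrow> j < n \<Longrightarrow> central_entries n r
      (\<lambda>a b. \<theta> (mat_unit n i j) $$ (a, b) - c * of_bool (i = a \<and> j = b))"
    using central_shift[OF two r] by blast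
  define \<mu> where "\<mu> = (\<lambda>x. \<theta> x - c \<cdot>\<^sub>m x)"
  have \<mu>_carrier: "\<mu> x \<in> carrier_mat n n" if "x \<in> carrier_mat n n" for x
    using maps[OF that] that by (simp add: \<mu>_def minus_carrier_mat)
  have comm_\<mu>: "comm_entry r (\<mu> x) y a b = comm_entry r (\<theta> x) y a b - c * comm_entry r x y a b"
    if "x \<in> carrier_mat n n" "y \<in> carrier_mat n n" "a < n" "b < n" for x y a b
    unfolding comm_entry_def sum_distrib_left sum_subtractf[symmetric]
    using maps[OF that(1)] that r by (intro sum.cong) (auto simp: \<mu>_def algebra_simps)
  have unit: "central_entries n r (\<lambda>a b. \<mu> (mat_unit n k l) $$ (a, b))" if "k < n" "l < n" for k l
  proof -
    have "\<mu> (mat_unit n k l) $$ (a, b) = \<theta> (mat_unit n k l) $$ (a, b) - c * of_bool (k = a \<and> l = b)"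
      if "a < n" "b < n" for a b
      using that by (simp add: \<mu>_def)
    then show ?thesis
      using c[OF that] by (simp cong: central_entries_cong)
  qed
  have central: "\<mu> x \<in> alg_center (inflated_algebra n r)" if x: "x \<in> carrier_mat n n" for x
    unfolding alg_center_inflated[OF r]
  proof (intro conjI \<mu>_carrier[OF x] central_entriesI[OF \<mu>_carrier[OF x] r])
    fix k l a b assume *: "k < n" "l < n" "a < n" "b < n"
    let ?E = "mat_unit n k l :: 'k mat"
    have "comm_entry r (\<mu> x) ?E a b = comm_entry r (\<theta> x) ?E a b - c * comm_entry r x ?E a b"
      using comm_\<mu> x * by simp
    \<comment> \<open>Polarisation moves the map from \<open>x\<close> to the matrix unit, whose
      value under \<open>\<mu>\<close> is already central; \<open>x\<close> itself need not be
      expanded in units.\<close>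
    also have "\<dots> = - (comm_entry r (\<theta> ?E) x a b - c * comm_entry r ?E x a b)"
      using commuting_map_polar[OF \<theta> r x mat_unit_carrier *(3,4), of k l]
        comm_entry_minus[of r x "\<theta> ?E" a b] comm_entry_minus[of r x ?E a b]
      by simp
    also have "\<dots> = - comm_entry r (\<mu> ?E) x a b"
      using comm_\<mu> x * by simp
    also have "\<dots> = 0"
      using central_entries_comm[OF unit r] * by simp
    finally show "comm_entry r (\<mu> x) ?E a b = 0" .
  qed
  show ?thesis
  proof (rule that[of \<mu> c])
    show "alg_linear (inflated_algebra n r) \<mu>"
      unfolding alg_linear_def inflated_algebra_simps
    proof (intro conjI ballI allI)
      show "\<mu> \<in> carrier_mat n n \<rightarrow> carrier_mat n n" using \<mu>_carrier by auto
    next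
      fix x y :: "'k mat" assume xy: "x \<in> carrier_mat n n" "y \<in> carrier_mat n n"
      show "\<mu> (x + y) = \<mu> x + \<mu> y"
        unfolding \<mu>_def add[OF xy] using xy maps[OF xy(1)] maps[OF xy(2)]
        by (intro eq_matI) (auto simp: algebra_simps)
    next
      fix d and x :: "'k mat" assume x: "x \<in> carrier_mat n n"
      show "\<mu> (d \<cdot>\<^sub>m x) = d \<cdot>\<^sub>m \<mu> x"
        unfolding \<mu>_def scale[OF x] using x maps[OF x]
        by (intro eq_matI) (auto simp: algebra_simps)
    qed
    show "\<mu> ` carrier (inflated_algebra n r) \<subseteq> alg_center (inflated_algebra n r)"
      using central by (auto simp: inflated_algebra_simps(1))
    show "\<forall>x\<in>carrier_mat n n. \<theta> x = c \<cdot>\<^sub>m x + \<mu> x"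
    proof
      fix x :: "'k mat" assume x: "x \<in> carrier_mat n n"
      show "\<theta> x = c \<cdot>\<^sub>m x + \<mu> x"
        using x maps[OF x] by (intro eq_matI) (auto simp: \<mu>_def)
    qed
  qed
qed

section \<open>Standard form, and properness for \<open>r = n\<close>\<close>

lemma zero_in_center:
  "r \<le> n \<Longrightarrow> (0\<^sub>m n n :: 'k::field mat) \<in> alg_center (inflated_algebra n r)"
  by (auto simp: alg_center_inflated central_entries_def)

text \<open>The scalar \<open>c\<close> accounts for the whole multiple of \<open>x\<close>, so the
  central multiplier can be zero.\<close>

lemma commuting_map_standard:
  fixes \<theta> :: "'k::field mat \<Rightarrow> 'k mat"
  assumes \<theta>: "commuting_map (inflated_algebra n r) \<theta>" and r: "r \<le> n" and two: "(2::'k) \<noteq> 0"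
  shows "standard_commuting_map (inflated_algebra n r) \<theta>"
proof -
  obtain \<mu> c where \<mu>: "alg_linear (inflated_algebra n r) \<mu>"
    "\<mu> ` carrier (inflated_algebra n r) \<subseteq> alg_center (inflated_algebra n r)"
    "\<forall>x\<in>carrier_mat n n. \<theta> x = c \<cdot>\<^sub>m x + \<mu> x"
    by (rule commuting_map_decomposition[OF assms])
  have P: "inflation_matrix n r \<in> carrier_mat n n"
    using r by (auto simp: inflation_matrix_def)
  have "\<theta> x = c \<cdot>\<^sub>m x + 0\<^sub>m n n * inflation_matrix n r * x + \<mu> x" if x: "x \<in> carrier_mat n n" for x
    using bspec[OF \<mu>(3) x]
    by (simp add: left_mult_zero_mat[OF P] left_mult_zero_mat[OF x]
        right_add_zero_mat[OF smult_carrier_mat[OF x]])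
  then show ?thesis
    unfolding standard_commuting_map_def
    using \<theta> \<mu>(1,2) zero_in_center[OF r, where 'k = 'k]
    by (intro conjI exI[of _ c] bexI[of _ "0\<^sub>m n n"] exI[of _ \<mu>])
      (auto simp: inflated_algebra_simps)
qed

lemma commuting_map_full_proper:
  fixes \<theta> :: "'k::field mat \<Rightarrow> 'k mat"
  assumes \<theta>: "commuting_map (inflated_algebra n n) \<theta>" and two: "(2::'k) \<noteq> 0"
  shows "proper_commuting_map (inflated_algebra n n) \<theta>"
proof -
  obtain \<mu> c where \<mu>: "alg_linear (inflated_algebra n n) \<mu>"
    "\<mu> ` carrier (inflated_algebra n n) \<subseteq> alg_center (inflated_algebra n n)"
    "\<forall>x\<in>carrier_mat n n. \<theta> x = c \<cdot>\<^sub>m x + \<mu> x"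
    by (rule commuting_map_decomposition[OF \<theta> le_refl two])
  have P: "inflation_matrix n n = (1\<^sub>m n :: 'k mat)"
    by (rule eq_matI) (auto simp: inflation_matrix_def)
  have center: "c \<cdot>\<^sub>m 1\<^sub>m n \<in> alg_center (inflated_algebra n n)"
    by (auto simp: alg_center_inflated central_entries_def)
  have "\<theta> x = (c \<cdot>\<^sub>m 1\<^sub>m n) * inflation_matrix n n * x + \<mu> x" if x: "x \<in> carrier_mat n n" for x
    using bspec[OF \<mu>(3) x] x by (simp add: P smult_carrier_mat mult_smult_assoc_mat[of _ n n _ n])
  then show ?thesis
    unfolding proper_commuting_map_def
    using \<theta> \<mu>(1,2) center
    by (intro conjI bexI[of _ "c \<cdot>\<^sub>m 1\<^sub>m n"] exI[of _ \<mu>]) (auto simp: inflated_algebra_simps)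
qed

section \<open>The identity map as a counterexample for \<open>1 \<le> r < n\<close>\<close>

lemma identity_commuting:
  "r \<le> n \<Longrightarrow> commuting_map (inflated_algebra n r) (\<lambda>x :: 'k::field mat. x)"
  unfolding commuting_map_def alg_linear_def
  by (auto simp: inflated_algebra_simps(1) alg_commutator_zero_iff comm_entry_def)

text \<open>Both summands of a proper form vanish at the entry \<open>(0, n - 1)\<close> when
  applied to the matrix unit there, whose own entry is 1.\<close>

lemma identity_not_proper:
  assumes r: "1 \<le> r" "r < n"
  shows "\<not> proper_commuting_map (inflated_algebra n r) (\<lambda>x :: 'k::field mat. x)"
proof
  assume "proper_commuting_map (inflated_algebra n r) (\<lambda>x :: 'k mat. x)"
  then obtain l \<mu> where l: "l \<in> alg_center (inflated_algebra n r)"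
    and \<mu>: "\<mu> ` carrier_mat n n \<subseteq> alg_center (inflated_algebra n r)"
    and eq: "\<And>x :: 'k mat. x \<in> carrier_mat n n \<Longrightarrow> x = l * inflation_matrix n r * x + \<mu> x"
    unfolding proper_commuting_map_def inflated_algebra_simps by blast
  let ?m = "n - 1" and ?E = "mat_unit n 0 (n - 1) :: 'k mat"
  have lc: "l \<in> carrier_mat n n" "central_entries n r (\<lambda>a b. l $$ (a, b))"
    using l r by (auto simp: alg_center_inflated)
  have \<mu>c: "\<mu> ?E \<in> carrier_mat n n" "central_entries n r (\<lambda>a b. \<mu> ?E $$ (a, b))"
    using \<mu> r alg_center_inflated[of r n "\<mu> ?E"]
    by (auto simp: image_subset_iff)
  have l0: "l $$ (0, c) = 0" if "c < r" for c
  proof (cases "c = 0")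
    case True
    \<comment> \<open>The index \<open>n - 1\<close> is not below \<open>r\<close> and has weight 0,
      so the diagonal condition compares \<open>l $$ (0, 0)\<close> with zero.\<close>
    have "0 < r" "\<not> ?m < r" "0 < n" "?m < n"
      using r by linarith+
    then have "l $$ (0, 0) = 0"
      using central_entries_diag[OF lc(2), of 0 ?m] by (simp only: of_bool_eq mult_1 mult_zero_left)
    then show ?thesis using True by simp
  next
    case False
    then show ?thesis using central_entries_off[OF lc(2), of 0 c] r that by simp
  qed
  have m0: "\<mu> ?E $$ (0, ?m) = 0"
    using central_entries_off[OF \<mu>c(2), of 0 ?m] r by simp
  have "?E $$ (0, ?m) = (l * inflation_matrix n r * ?E + \<mu> ?E) $$ (0, ?m)"
    using eq[OF mat_unit_carrier, of 0 "n - 1"] by simp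
  also have "\<dots> = (l * inflation_matrix n r * ?E) $$ (0, ?m) + \<mu> ?E $$ (0, ?m)"
    using \<mu>c(1) r by (intro index_add_mat) auto
  also have "\<dots> = 0"
    using r lc(1) unfolding m0 by (simp add: inflated_mult_entry l0 del: index_mult_mat(1))
  finally show False
    using r by simp
qed

theorem theorem3p9:
  fixes n r :: nat
  assumes "CHAR('k::field) \<noteq> 2" and "n \<ge> 1" and "r \<le> n"
  shows "(\<forall>\<theta> :: 'k mat \<Rightarrow> 'k mat.
            commuting_map (inflated_algebra n r) \<theta> \<longrightarrow>
            standard_commuting_map (inflated_algebra n r) \<theta>) \<and>
         (r \<ge> 1 \<longrightarrow>
           ((\<forall>\<theta> :: 'k mat \<Rightarrow> 'k mat.
               commuting_map (inflated_algebra n r) \<theta> \<longrightarrow>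
               proper_commuting_map (inflated_algebra n r) \<theta>)
            \<longleftrightarrow> {r + 1..n} = {}))"
proof -
  have two: "(2::'k) \<noteq> 0"
  proof
    assume "(2::'k) = 0"
    then have "CHAR('k) dvd 2"
      using of_nat_eq_0_iff_char_dvd[where 'a = 'k, of 2] by simp
    \<comment> \<open>A divisor of 2 is 1 or 2, and a characteristic is never 1.\<close>
    then have "CHAR('k) \<le> 2" "CHAR('k) \<noteq> 0"
      by (auto intro!: dvd_imp_le gr0I)
    then show False
      using assms(1) CHAR_not_1[where 'a = 'k] by linarith
  qed
  show ?thesis
  proof (intro conjI impI allI)
    fix \<theta> :: "'k mat \<Rightarrow> 'k mat" assume "commuting_map (inflated_algebra n r) \<theta>"
    then show "standard_commuting_map (inflated_algebra n r) \<theta>"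
      using commuting_map_standard assms(3) two by blast
  next
    assume "r \<ge> 1"
    \<comment> \<open>If \<open>r < n\<close>, the identity map would be commuting without being
      proper.\<close>
    then have "r = n"
      if "\<forall>\<theta> :: 'k mat \<Rightarrow> 'k mat. commuting_map (inflated_algebra n r) \<theta> \<longrightarrow>
        proper_commuting_map (inflated_algebra n r) \<theta>"
      using that identity_commuting[OF assms(3), where 'k = 'k]
        identity_not_proper[of r n, where 'k = 'k] assms(3) by fastforce
    moreover have "{r + 1..n} = {} \<longleftrightarrow> r = n"
      using assms(3) by auto
    ultimately show "(\<forall>\<theta> :: 'k mat \<Rightarrow> 'k mat. commuting_map (inflated_algebra n r) \<theta> \<longrightarrow>
        proper_commuting_map (inflated_algebra n r) \<theta>) \<longleftrightarrow> {r + 1..n} = {}"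
      using commuting_map_full_proper[OF _ two] by auto
  qed
qed

end
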